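(* There exist polynomial time algorithms that, given an instance of the game PREC, compute $2$-optimal mixed strategies for both players (the Hider and the Searcher).
   Context: The game PREC (searching in boxes with precedence constraints): an instance consists of $n$ boxes $[n]=\{1,\ldots,n\}$ with positive integer costs $c_1,\ldots,c_n$ and a partial order $\prec$ on $[n]$. A pure strategy for the Hider (the maximizer) is a box $j\in[n]$. A pure strategy for the Searcher (the minimizer) is a permutation $\pi:[n]\to[n]$ ($\pi(i)$ being the $i$th box to be searched) that is consistent with the precedence constraints: if $i\prec j$ and $i\ne j$, then box $i$ is searched before box $j$. The payoff is the search cost $$C(j,\pi)=\sum_{i\le \pi^{-1}(j)}c_{\pi(i)},$$ extended to mixed strategies by expectation. Let $V^*$ be the value of the zero-sum game. A mixed strategy $\hat{\mathbf{x}}$ of the Hider is $\alpha$-optimal if $C(\hat{\mathbf{x}},\mathbf{y})\ge V^*/\alpha$ for every Searcher mixed strategy $\mathbf{y}$; a mixed strategy $\hat{\mathbf{y}}$ of the Searcher is $\alpha$-optimal if $C(\mathbf{x},\hat{\mathbf{y}})\le \alpha V^*$ for every Hider mixed strategy $\mathbf{x}$. Polynomial time means time polynomial in $n$ and the logarithm of the largest payoff. Mixed strategies are output in sparse form (a list of the non-zero entries with their indices). *)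

theory Defs
  imports
    "HOL-Probability.Probability"
    "HOL-Combinatorics.Permutations"
    "HOL-Computational_Algebra.Polynomial"
    "HOL-Library.Log_Nat"
begin

text \<open>
  A term \<open>(i, j) \<in> prec I\<close> stands for \<open>i \<preceq> j\<close>: the partial order is reflexive, so the
  precedence constraints are its pairs with \<open>i \<noteq> j\<close>. At least one box is required, since
  otherwise the Hider has no strategy.
\<close>

record prec_instance =
  boxes :: nat
  cost :: "nat \<Rightarrow> nat"
  prec :: "nat rel"

definition prec_game :: "prec_instance set" where
  "prec_game = {I. boxes I \<ge> 1 \<and> (\<forall>i\<in>{1..boxes I}. cost I i > 0) \<and>
     partial_order_on {1..boxes I} (prec I)}"

definition hider_pure :: "prec_instance \<Rightarrow> nat set" where
  "hider_pure I = {1..boxes I}"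

definition searcher_pure :: "prec_instance \<Rightarrow> (nat \<Rightarrow> nat) set" where
  "searcher_pure I = {\<pi>. \<pi> permutes {1..boxes I} \<and>
     (\<forall>(i, j)\<in>prec I. i \<noteq> j \<longrightarrow> inv \<pi> i < inv \<pi> j)}"

definition search_cost :: "prec_instance \<Rightarrow> nat \<Rightarrow> (nat \<Rightarrow> nat) \<Rightarrow> nat" where
  "search_cost I j \<pi> = (\<Sum>i = 1..inv \<pi> j. cost I (\<pi> i))"

definition largest_payoff :: "prec_instance \<Rightarrow> nat" where
  "largest_payoff I = Max {search_cost I j \<pi> | j \<pi>. j \<in> hider_pure I \<and> \<pi> \<in> searcher_pure I}"

definition hider_mixed :: "prec_instance \<Rightarrow> nat pmf set" where
  "hider_mixed I = {x. set_pmf x \<subseteq> hider_pure I}"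

definition searcher_mixed :: "prec_instance \<Rightarrow> (nat \<Rightarrow> nat) pmf set" where
  "searcher_mixed I = {y. set_pmf y \<subseteq> searcher_pure I}"

definition expected_cost :: "prec_instance \<Rightarrow> nat pmf \<Rightarrow> (nat \<Rightarrow> nat) pmf \<Rightarrow> real" where
  "expected_cost I x y =
     measure_pmf.expectation (pair_pmf x y) (\<lambda>(j, \<pi>). real (search_cost I j \<pi>))"

text \<open>
  The value is written as the maximin over mixed strategies. Both pure strategy sets are finite,
  so by von Neumann's theorem it is also the minimax, and the supremum and infimum are attained.
\<close>

definition game_value :: "prec_instance \<Rightarrow> real" where
  "game_value I = (SUP x\<in>hider_mixed I. INF y\<in>searcher_mixed I. expected_cost I x y)"

definition hider_optimal :: "real \<Rightarrow> prec_instance \<Rightarrow> nat pmf \<Rightarrow> bool" where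
  "hider_optimal \<alpha> I x \<longleftrightarrow> x \<in> hider_mixed I \<and>
     (\<forall>y\<in>searcher_mixed I. expected_cost I x y \<ge> game_value I / \<alpha>)"

definition searcher_optimal :: "real \<Rightarrow> prec_instance \<Rightarrow> (nat \<Rightarrow> nat) pmf \<Rightarrow> bool" where
  "searcher_optimal \<alpha> I y \<longleftrightarrow> y \<in> searcher_mixed I \<and>
     (\<forall>x\<in>hider_mixed I. expected_cost I x y \<le> \<alpha> * game_value I)"

text \<open>
  The machine model is a random access machine under the logarithmic cost criterion, programmed
  with structured control flow. A state has registers, named by fixed numbers in the program
  text; a memory, reachable only by indirect addressing; and a write-only output. The arithmetic
  consists of addition and truncated subtraction of natural numbers. Every instruction costs one
  plus the number of bits of the numbers it handles, including memory addresses, so polynomial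
  time in this model coincides with polynomial time on Turing machines.
\<close>

type_synonym reg = nat

record state =
  regs :: "reg \<Rightarrow> nat"
  mem :: "nat \<Rightarrow> nat"
  written :: "nat list"

datatype com =
    Skip
  | SetConst reg nat
  | Add reg reg reg
  | Sub reg reg reg
  | Load reg reg
  | Store reg reg
  | Write reg
  | Seq com com
  | IfNonzero reg com com
  | WhileNonzero reg com

definition bits :: "nat \<Rightarrow> nat" where
  "bits k = floorlog 2 k"

definition set_reg :: "reg \<Rightarrow> nat \<Rightarrow> state \<Rightarrow> state" where
  "set_reg a k s = s\<lparr>regs := (regs s)(a := k)\<rparr>"

text \<open>\<open>exec P s t s'\<close>: started in \<open>s\<close>, program \<open>P\<close> halts in \<open>s'\<close> after time \<open>t\<close>.\<close>

inductive exec :: "com \<Rightarrow> state \<Rightarrow> nat \<Rightarrow> state \<Rightarrow> bool" where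
  Skip: "exec Skip s 1 s"
| SetConst: "exec (SetConst a k) s (1 + bits k) (set_reg a k s)"
| Add: "exec (Add a b c) s (1 + bits (regs s b) + bits (regs s c))
    (set_reg a (regs s b + regs s c) s)"
| Sub: "exec (Sub a b c) s (1 + bits (regs s b) + bits (regs s c))
    (set_reg a (regs s b - regs s c) s)"
| Load: "exec (Load a b) s (1 + bits (regs s b) + bits (mem s (regs s b)))
    (set_reg a (mem s (regs s b)) s)"
| Store: "exec (Store a b) s (1 + bits (regs s a) + bits (regs s b))
    (s\<lparr>mem := (mem s)(regs s a := regs s b)\<rparr>)"
| Write: "exec (Write a) s (1 + bits (regs s a)) (s\<lparr>written := written s @ [regs s a]\<rparr>)"
| Seq: "exec P s t s' \<Longrightarrow> exec Q s' u s'' \<Longrightarrow> exec (Seq P Q) s (t + u) s''"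
| IfTrue: "regs s a \<noteq> 0 \<Longrightarrow> exec P s t s' \<Longrightarrow>
    exec (IfNonzero a P Q) s (1 + bits (regs s a) + t) s'"
| IfFalse: "regs s a = 0 \<Longrightarrow> exec Q s t s' \<Longrightarrow>
    exec (IfNonzero a P Q) s (1 + bits (regs s a) + t) s'"
| WhileTrue: "regs s a \<noteq> 0 \<Longrightarrow> exec P s t s' \<Longrightarrow> exec (WhileNonzero a P) s' u s'' \<Longrightarrow>
    exec (WhileNonzero a P) s (1 + bits (regs s a) + t + u) s''"
| WhileFalse: "regs s a = 0 \<Longrightarrow> exec (WhileNonzero a P) s (1 + bits (regs s a)) s"

inductive_cases exec_SkipE: "exec Skip s t s'"
inductive_cases exec_SetConstE: "exec (SetConst a k) s t s'"
inductive_cases exec_AddE: "exec (Add a b c) s t s'"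
inductive_cases exec_SubE: "exec (Sub a b c) s t s'"
inductive_cases exec_LoadE: "exec (Load a b) s t s'"
inductive_cases exec_StoreE: "exec (Store a b) s t s'"
inductive_cases exec_WriteE: "exec (Write a) s t s'"
inductive_cases exec_SeqE: "exec (Seq P Q) s t s'"
inductive_cases exec_IfE: "exec (IfNonzero a P Q) s t s'"
inductive_cases exec_WhileE: "exec (WhileNonzero a P) s t s'"

lemma exec_deterministic:
  "exec P s t s' \<Longrightarrow> exec P s u s'' \<Longrightarrow> u = t \<and> s'' = s'"
proof (induction arbitrary: u s'' rule: exec.induct)
  case Skip
  then show ?case by (rule exec_SkipE) simp
next
  case SetConst
  then show ?case by (rule exec_SetConstE) simp
next
  case Add
  then show ?case by (rule exec_AddE) simp
next
  case Sub
  then show ?case by (rule exec_SubE) simp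
next
  case Load
  then show ?case by (rule exec_LoadE) simp
next
  case Store
  then show ?case by (rule exec_StoreE) simp
next
  case Write
  then show ?case by (rule exec_WriteE) simp
next
  case (Seq P s t s' Q v s3)
  from Seq.prems obtain t1 t2 s1 where
    *: "u = t1 + t2" "exec P s t1 s1" "exec Q s1 t2 s''"
    by (rule exec_SeqE)
  from Seq.IH(1)[OF *(2)] have "t1 = t" "s1 = s'" by auto
  with Seq.IH(2)[of t2 s''] * show ?case by simp
next
  case (IfTrue s a P t s' Q)
  from IfTrue.prems show ?case
  proof (rule exec_IfE)
    fix t1 assume "u = Suc (bits (regs s a) + t1)" "exec P s t1 s''"
    with IfTrue.IH[of t1 s''] show ?thesis by simp
  qed (use IfTrue.hyps in simp)
next
  case (IfFalse s a Q t s' P)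
  from IfFalse.prems show ?case
  proof (rule exec_IfE)
    fix t1 assume "u = Suc (bits 0 + t1)" "exec Q s t1 s''"
    with IfFalse.IH[of t1 s''] IfFalse.hyps show ?thesis by simp
  qed (use IfFalse.hyps in simp)
next
  case (WhileTrue s a P t s' v s3)
  from WhileTrue.prems show ?case
  proof (rule exec_WhileE)
    fix t1 s1 t2
    assume *: "u = Suc (bits (regs s a) + t1 + t2)" "exec P s t1 s1"
      "exec (WhileNonzero a P) s1 t2 s''"
    from WhileTrue.IH(1)[OF *(2)] have "t1 = t" "s1 = s'" by auto
    with WhileTrue.IH(2)[of t2 s''] * show ?thesis by simp
  qed (use WhileTrue.hyps in simp)
next
  case (WhileFalse s a P)
  from WhileFalse.prems show ?case
    by (rule exec_WhileE) (use WhileFalse.hyps in simp_all)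
qed

text \<open>The input occupies memory cells \<open>0, 1, \<dots>\<close>, and register \<open>0\<close> holds its length.\<close>

definition initial :: "nat list \<Rightarrow> state" where
  "initial xs = \<lparr>regs = (\<lambda>_. 0)(0 := length xs),
     mem = (\<lambda>i. if i < length xs then xs ! i else 0), written = []\<rparr>"

definition poly_time_solves ::
  "com \<Rightarrow> 'i set \<Rightarrow> ('i \<Rightarrow> nat list) \<Rightarrow> ('i \<Rightarrow> real) \<Rightarrow> ('i \<Rightarrow> nat list \<Rightarrow> bool) \<Rightarrow> bool" where
  "poly_time_solves P A enc sz sol \<longleftrightarrow>
     (\<exists>p :: real poly. \<forall>I\<in>A. \<exists>t s. exec P (initial (enc I)) t s \<and>
        real t \<le> poly p (sz I) \<and> sol I (written s))"

text \<open>
  The input consists of \<open>n\<close>, the costs, and the \<open>n \<times> n\<close> zero-one matrix of the partial order.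
  For nonnegative arguments, being bounded by a polynomial in \<open>n\<close> and \<open>log P\<close> is the same as being
  bounded by a polynomial in their sum.
\<close>

definition encode_instance :: "prec_instance \<Rightarrow> nat list" where
  "encode_instance I = boxes I # map (cost I) [1..<boxes I + 1] @
     concat (map (\<lambda>i. map (\<lambda>j. of_bool ((i, j) \<in> prec I)) [1..<boxes I + 1]) [1..<boxes I + 1])"

definition instance_size :: "prec_instance \<Rightarrow> real" where
  "instance_size I = real (boxes I) + log 2 (real (largest_payoff I))"

text \<open>
  An entry \<open>(a, p, q)\<close> says that the pure strategy \<open>a\<close> has probability \<open>p / q\<close>. In the output,
  the index of a Searcher strategy \<open>\<pi>\<close> is written as \<open>\<pi> 1, \<dots>, \<pi> n\<close>.
\<close>

definition sparse_form :: "'a pmf \<Rightarrow> ('a \<times> nat \<times> nat) list \<Rightarrow> bool" where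
  "sparse_form x es \<longleftrightarrow> distinct (map fst es) \<and> fst ` set es = set_pmf x \<and>
     (\<forall>(a, p, q)\<in>set es. q > 0 \<and> pmf x a = real p / real q)"

definition encode_hider :: "(nat \<times> nat \<times> nat) list \<Rightarrow> nat list" where
  "encode_hider es = concat (map (\<lambda>(j, p, q). [j, p, q]) es)"

definition encode_searcher :: "nat \<Rightarrow> ((nat \<Rightarrow> nat) \<times> nat \<times> nat) list \<Rightarrow> nat list" where
  "encode_searcher n es = concat (map (\<lambda>(\<pi>, p, q). map \<pi> [1..<n + 1] @ [p, q]) es)"

definition hider_solution :: "real \<Rightarrow> prec_instance \<Rightarrow> nat list \<Rightarrow> bool" where
  "hider_solution \<alpha> I zs \<longleftrightarrow>
     (\<exists>x es. hider_optimal \<alpha> I x \<and> sparse_form x es \<and> zs = encode_hider es)"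

definition searcher_solution :: "real \<Rightarrow> prec_instance \<Rightarrow> nat list \<Rightarrow> bool" where
  "searcher_solution \<alpha> I zs \<longleftrightarrow>
     (\<exists>y es. searcher_optimal \<alpha> I y \<and> sparse_form y es \<and> zs = encode_searcher (boxes I) es)"

end

theory Submission
  imports Defs
begin

text \<open>
  Let \<open>S\<close> be the sum of all costs. Against the Hider strategy that chooses box \<open>j\<close> with
  probability \<open>c j / S\<close>, every search order has expected cost
  \<open>(\<Sum>l. c (\<pi> l) * (\<Sum>i\<le>l. c (\<pi> i))) / S\<close>. Twice the double sum counts every ordered pair of boxes
  at least once, so this is at least \<open>S / 2\<close>. As no payoff exceeds \<open>S\<close>, the value of the game lies
  between \<open>S / 2\<close> and \<open>S\<close>. Hence this strategy of the Hider is 2-optimal, and so is every pure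
  strategy of the Searcher. A search order respecting the constraints is obtained by sorting the
  boxes by their number of predecessors, which is strictly monotone by transitivity.
\<close>

section \<open>The value of the game\<close>

definition total_cost :: "prec_instance \<Rightarrow> nat" where
  "total_cost I = (\<Sum>j = 1..boxes I. cost I j)"

text \<open>The right side exceeds the left by the sum of the squares \<open>(a l)\<^sup>2\<close>:
  the triangle includes the diagonal, so doubling counts the diagonal pairs twice.\<close>

lemma sum_square_le_triangle:
  fixes a :: "nat \<Rightarrow> nat"
  shows "(\<Sum>l = 1..n. a l)\<^sup>2 \<le> 2 * (\<Sum>l = 1..n. a l * (\<Sum>i = 1..l. a i))"
  by (induction n) (auto simp: power2_eq_square algebra_simps)

text \<open>Costs are positive integers, hence at least 1. Box numbers and loop counters of the
  Hider program are therefore bounded by the total cost.\<close>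

lemma boxes_le_total_cost:
  assumes "I \<in> prec_game"
  shows "boxes I \<le> total_cost I"
proof -
  have "(\<Sum>j = 1..boxes I. 1) \<le> total_cost I"
    unfolding total_cost_def by (rule sum_mono) (use assms in \<open>auto simp: prec_game_def Suc_le_eq\<close>)
  then show ?thesis by simp
qed

lemma total_cost_pos: "I \<in> prec_game \<Longrightarrow> 0 < total_cost I"
  using boxes_le_total_cost[of I] by (auto simp: prec_game_def)

lemma total_cost_permute:
  assumes "\<pi> permutes {1..boxes I}"
  shows "(\<Sum>l = 1..boxes I. cost I (\<pi> l)) = total_cost I"
  unfolding total_cost_def using sum.permute[OF assms, of "cost I"] by (simp add: o_def)

lemma search_cost_le_total_cost:
  assumes "j \<in> hider_pure I" "\<pi> \<in> searcher_pure I"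
  shows "search_cost I j \<pi> \<le> total_cost I"
proof -
  have p: "\<pi> permutes {1..boxes I}"
    using assms by (simp add: searcher_pure_def)
  then have "inv \<pi> j \<in> {1..boxes I}"
    using assms permutes_in_image[OF permutes_inv[OF p]] by (simp add: hider_pure_def)
  then have "search_cost I j \<pi> \<le> (\<Sum>l = 1..boxes I. cost I (\<pi> l))"
    unfolding search_cost_def by (intro sum_mono2) auto
  then show ?thesis using total_cost_permute[OF p] by simp
qed

lemma total_cost_square_le:
  assumes "\<pi> \<in> searcher_pure I"
  shows "(total_cost I)\<^sup>2 \<le> 2 * (\<Sum>j = 1..boxes I. cost I j * search_cost I j \<pi>)"
proof -
  have p: "\<pi> permutes {1..boxes I}"
    using assms by (simp add: searcher_pure_def)
  \<comment> \<open>Reindexing by the position \<open>l\<close> at which a box is searched turns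
    each search cost into a prefix sum.\<close>
  have "(\<Sum>j = 1..boxes I. cost I j * search_cost I j \<pi>) =
    (\<Sum>l = 1..boxes I. cost I (\<pi> l) * search_cost I (\<pi> l) \<pi>)"
    using sum.permute[OF p, of "\<lambda>j. cost I j * search_cost I j \<pi>"] by (simp add: o_def)
  also have "\<dots> = (\<Sum>l = 1..boxes I. cost I (\<pi> l) * (\<Sum>i = 1..l. cost I (\<pi> i)))"
    by (simp add: search_cost_def permutes_inverses(2)[OF p])
  finally show ?thesis
    using sum_square_le_triangle[of "\<lambda>l. cost I (\<pi> l)" "boxes I"] total_cost_permute[OF p] by simp
qed

lemma finite_searcher_pure: "finite (searcher_pure I)"
  by (rule finite_subset[of _ "{\<pi>. \<pi> permutes {1..boxes I}}"])
    (auto simp: searcher_pure_def finite_permutations)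

text \<open>The box searched last costs everything. This bounds the bit length of the total cost by
  the size measure of the instance.\<close>

lemma total_cost_le_largest_payoff:
  assumes "I \<in> prec_game" "\<pi> \<in> searcher_pure I"
  shows "total_cost I \<le> largest_payoff I"
proof -
  have p: "\<pi> permutes {1..boxes I}"
    using assms by (simp add: searcher_pure_def)
  have "\<pi> (boxes I) \<in> hider_pure I"
    unfolding hider_pure_def permutes_in_image[OF p] using assms by (simp add: prec_game_def)
  moreover have "search_cost I (\<pi> (boxes I)) \<pi> = total_cost I"
    using total_cost_permute[OF p] by (simp add: search_cost_def permutes_inverses(2)[OF p])
  moreover have "{search_cost I j \<pi> | j \<pi>. j \<in> hider_pure I \<and> \<pi> \<in> searcher_pure I} =
      (\<lambda>(j, \<pi>). search_cost I j \<pi>) ` (hider_pure I \<times> searcher_pure I)"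
    by auto
  moreover have "finite (hider_pure I \<times> searcher_pure I)"
    using finite_searcher_pure by (simp add: hider_pure_def)
  ultimately show ?thesis
    unfolding largest_payoff_def
    by (metis (mono_tags, lifting) Max_ge assms(2) case_prod_conv finite_imageI image_eqI mem_Sigma_iff)
qed

section \<open>Expected cost as a finite sum\<close>

text \<open>Both pure strategy sets are finite. The sum over search orders is placed outside so that
  a bound valid for each order can be averaged with the weights of \<open>y\<close>.\<close>

lemma expected_cost_eq_sum:
  assumes "y \<in> searcher_mixed I" "x \<in> hider_mixed I"
  shows "expected_cost I x y =
    (\<Sum>\<pi>\<in>searcher_pure I. pmf y \<pi> * (\<Sum>j = 1..boxes I. pmf x j * search_cost I j \<pi>))"
proof -
  have "expected_cost I x y =
    (\<Sum>(j, \<pi>)\<in>{1..boxes I} \<times> searcher_pure I. pmf x j * pmf y \<pi> * search_cost I j \<pi>)"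
    unfolding expected_cost_def
    by (subst integral_measure_pmf_real[where A = "{1..boxes I} \<times> searcher_pure I"])
      (use assms finite_searcher_pure in
        \<open>auto simp: hider_mixed_def searcher_mixed_def hider_pure_def pmf_pair mult_ac
          intro!: sum.cong\<close>)
  also have "\<dots> = (\<Sum>j = 1..boxes I. \<Sum>\<pi>\<in>searcher_pure I. pmf x j * pmf y \<pi> * search_cost I j \<pi>)"
    by (simp add: sum.cartesian_product)
  also have "\<dots> = (\<Sum>\<pi>\<in>searcher_pure I. \<Sum>j = 1..boxes I. pmf x j * pmf y \<pi> * search_cost I j \<pi>)"
    by (rule sum.swap)
  finally show ?thesis
    by (simp add: sum_distrib_left mult_ac)
qed

lemma sum_pmf_searcher: "y \<in> searcher_mixed I \<Longrightarrow> (\<Sum>\<pi>\<in>searcher_pure I. pmf y \<pi>) = 1"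
  by (rule sum_pmf_eq_1) (auto simp: searcher_mixed_def finite_searcher_pure)

lemma sum_pmf_hider: "x \<in> hider_mixed I \<Longrightarrow> (\<Sum>j = 1..boxes I. pmf x j) = 1"
  by (rule sum_pmf_eq_1) (auto simp: hider_mixed_def hider_pure_def)

lemma expected_cost_nonneg: "0 \<le> expected_cost I x y"
  unfolding expected_cost_def by (rule Bochner_Integration.integral_nonneg) auto

lemma expected_cost_le_total_cost:
  assumes "y \<in> searcher_mixed I" "x \<in> hider_mixed I"
  shows "expected_cost I x y \<le> total_cost I"
proof -
  have "expected_cost I x y \<le>
    (\<Sum>\<pi>\<in>searcher_pure I. pmf y \<pi> * (\<Sum>j = 1..boxes I. pmf x j * total_cost I))"
    unfolding expected_cost_eq_sum[OF assms]
    by (intro sum_mono mult_left_mono) (auto intro: search_cost_le_total_cost simp: hider_pure_def)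
  also have "\<dots> = total_cost I"
    by (simp only: sum_distrib_right[symmetric] sum_pmf_searcher sum_pmf_hider assms mult_1)
  finally show ?thesis .
qed

section \<open>The Hider strategy proportional to cost\<close>

definition proportional_hider :: "prec_instance \<Rightarrow> nat pmf" where
  "proportional_hider I =
     embed_pmf (\<lambda>j. if j \<in> {1..boxes I} then cost I j / total_cost I else 0)"

lemma pmf_proportional_hider:
  assumes "I \<in> prec_game"
  shows "pmf (proportional_hider I) j = (if j \<in> {1..boxes I} then cost I j / total_cost I else 0)"
  unfolding proportional_hider_def
proof (rule pmf_embed_pmf)
  let ?f = "\<lambda>j. if j \<in> {1..boxes I} then real (cost I j) / real (total_cost I) else 0"
  have "(\<integral>\<^sup>+ j. ennreal (?f j) \<partial>count_space UNIV) = (\<Sum>j = 1..boxes I. ennreal (?f j))"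
    by (rule nn_integral_count_space') auto
  also have "\<dots> = ennreal (\<Sum>j = 1..boxes I. ?f j)"
    by (rule sum_ennreal) auto
  also have "(\<Sum>j = 1..boxes I. ?f j) = real (total_cost I) / real (total_cost I)"
    unfolding total_cost_def of_nat_sum sum_divide_distrib by (rule sum.cong) auto
  also have "\<dots> = 1"
    using total_cost_pos[OF assms] by simp
  finally show "(\<integral>\<^sup>+ j. ennreal (?f j) \<partial>count_space UNIV) = 1" by simp
qed auto

text \<open>Positivity of the costs gives full support; a sparse form has to list exactly the
  support.\<close>

lemma set_proportional_hider:
  assumes "I \<in> prec_game"
  shows "set_pmf (proportional_hider I) = {1..boxes I}"
  using assms total_cost_pos[OF assms]
  by (auto simp: set_pmf_eq pmf_proportional_hider prec_game_def Ball_def)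

lemma proportional_hider_mixed: "I \<in> prec_game \<Longrightarrow> proportional_hider I \<in> hider_mixed I"
  by (simp add: hider_mixed_def hider_pure_def set_proportional_hider)

text \<open>For a single order, divide \<open>total_cost_square_le\<close> by
  \<open>2 * total_cost I\<close>. Averaging over orders with the weights of \<open>y\<close>, which
  sum to 1, preserves the bound.\<close>

lemma expected_cost_proportional_hider:
  assumes "I \<in> prec_game" "y \<in> searcher_mixed I"
  shows "total_cost I / 2 \<le> expected_cost I (proportional_hider I) y"
proof -
  have "real (total_cost I) / 2 \<le>
      (\<Sum>j = 1..boxes I. pmf (proportional_hider I) j * search_cost I j \<pi>)"
    if "\<pi> \<in> searcher_pure I" for \<pi>
  proof -
    have "(real (total_cost I))\<^sup>2 \<le> 2 * (\<Sum>j = 1..boxes I. real (cost I j) * search_cost I j \<pi>)"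
      using of_nat_mono[OF total_cost_square_le[OF that], where 'a = real] by simp
    then have "real (total_cost I) / 2 \<le>
        (\<Sum>j = 1..boxes I. real (cost I j) * search_cost I j \<pi>) / total_cost I"
      using total_cost_pos[OF assms(1)] by (simp add: field_simps power2_eq_square)
    also have "\<dots> = (\<Sum>j = 1..boxes I. pmf (proportional_hider I) j * search_cost I j \<pi>)"
      by (simp add: pmf_proportional_hider[OF assms(1)] sum_divide_distrib)
    finally show ?thesis .
  qed
  then have "(\<Sum>\<pi>\<in>searcher_pure I. pmf y \<pi> * (total_cost I / 2)) \<le>
      expected_cost I (proportional_hider I) y"
    unfolding expected_cost_eq_sum[OF assms(2) proportional_hider_mixed[OF assms(1)]]
    by (intro sum_mono mult_left_mono) auto
  then show ?thesis
    using assms(2) by (simp only: sum_distrib_right[symmetric] sum_pmf_searcher)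
qed

lemma return_searcher_mixed: "\<pi> \<in> searcher_pure I \<Longrightarrow> return_pmf \<pi> \<in> searcher_mixed I"
  by (simp add: searcher_mixed_def)

section \<open>Bounds on the value and 2-optimality\<close>

text \<open>The order \<open>\<pi>\<close> makes the infimum range over a nonempty set. Costs lie
  between 0 and \<open>total_cost I\<close>, which supplies the boundedness that suprema and infima
  of reals require.\<close>

lemma game_value_bounds:
  assumes "I \<in> prec_game" "\<pi> \<in> searcher_pure I"
  shows "total_cost I / 2 \<le> game_value I" "game_value I \<le> total_cost I"
proof -
  note ne = return_searcher_mixed[OF assms(2)]
  have le: "(INF y\<in>searcher_mixed I. expected_cost I x y) \<le> total_cost I"
    if "x \<in> hider_mixed I" for x
    by (rule cINF_lower2[OF _ ne])
      (auto intro!: bdd_belowI[of _ 0] expected_cost_nonneg expected_cost_le_total_cost that ne)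
  have "total_cost I / 2 \<le> (INF y\<in>searcher_mixed I. expected_cost I (proportional_hider I) y)"
    by (rule cINF_greatest) (use ne expected_cost_proportional_hider assms(1) in auto)
  then show "total_cost I / 2 \<le> game_value I"
    unfolding game_value_def
    by (intro cSUP_upper2[OF _ proportional_hider_mixed[OF assms(1)]])
      (auto intro!: bdd_aboveI[of _ "total_cost I"] le)
  show "game_value I \<le> total_cost I"
    unfolding game_value_def
    by (rule cSUP_least) (use proportional_hider_mixed[OF assms(1)] le in auto)
qed

text \<open>The Hider's guarantee uses the upper bound on the value, that of the Searcher below the
  lower bound.\<close>

lemma proportional_hider_optimal:
  assumes "I \<in> prec_game" "\<pi> \<in> searcher_pure I"
  shows "hider_optimal 2 I (proportional_hider I)"
  unfolding hider_optimal_def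
  using proportional_hider_mixed[OF assms(1)] expected_cost_proportional_hider[OF assms(1)]
    game_value_bounds(2)[OF assms] by fastforce

lemma pure_searcher_optimal:
  assumes "I \<in> prec_game" "\<pi> \<in> searcher_pure I"
  shows "searcher_optimal 2 I (return_pmf \<pi>)"
  unfolding searcher_optimal_def
  using return_searcher_mixed[OF assms(2)] expected_cost_le_total_cost
    game_value_bounds(1)[OF assms] by fastforce

section \<open>Sorting the boxes by the number of predecessors\<close>

text \<open>Induction on the upper end of the key range: the bucket appended last has the constant
  key \<open>c\<close>, which exceeds all earlier keys, so it is disjoint from the earlier buckets
  and keeps the list sorted.\<close>

lemma bucket_sort_props:
  fixes f :: "'a \<Rightarrow> nat"
  assumes "distinct xs" "a \<le> b"
  defines "L \<equiv> \<lambda>c. concat (map (\<lambda>k. filter (\<lambda>x. f x = k) xs) [a..<c])"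
  shows "set (L b) = {x \<in> set xs. a \<le> f x \<and> f x < b} \<and> distinct (L b) \<and> sorted (map f (L b))"
  using assms(2)
proof (induction b rule: dec_induct)
  case base
  then show ?case by (auto simp: L_def)
next
  case (step c)
  have "L (Suc c) = L c @ filter (\<lambda>x. f x = c) xs"
    using step.hyps by (simp add: L_def)
  moreover have "sorted (map f (filter (\<lambda>x. f x = c) xs))"
    by (induction xs) auto
  ultimately show ?case
    using step assms(1) by (auto simp: sorted_append less_Suc_eq)
qed

text \<open>A sum of matrix entries, as the program computes it; by reflexivity a box counts
  itself.\<close>

definition preds :: "prec_instance \<Rightarrow> nat \<Rightarrow> nat" where
  "preds I j = (\<Sum>i = 1..boxes I. of_bool ((i, j) \<in> prec I))"

text \<open>The nesting mirrors the loops of \<open>searcher_program\<close>: for each wanted count,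
  scan all boxes.\<close>

definition pred_order :: "prec_instance \<Rightarrow> nat list" where
  "pred_order I = concat (map (\<lambda>k. filter (\<lambda>j. preds I j = k) [1..<boxes I + 1]) [1..<boxes I + 1])"

text \<open>List positions start at 0, search positions at 1. Outside the boxes,
  \<open>permutes\<close> demands the identity.\<close>

definition pred_perm :: "prec_instance \<Rightarrow> nat \<Rightarrow> nat" where
  "pred_perm I k = (if k \<in> {1..boxes I} then pred_order I ! (k - 1) else k)"

lemma preds_eq_card: "preds I j = card {i \<in> {1..boxes I}. (i, j) \<in> prec I}"
  by (simp add: preds_def Int_def)

text \<open>Each box is its own predecessor, so the count is never 0 and the buckets
  \<open>1..n\<close> miss no box.\<close>

lemma preds_range:
  assumes "I \<in> prec_game" "j \<in> {1..boxes I}"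
  shows "1 \<le> preds I j" "preds I j \<le> boxes I"
proof -
  have "(j, j) \<in> prec I"
    using assms by (auto simp: prec_game_def partial_order_on_def preorder_on_def refl_on_def)
  then have "{i \<in> {1..boxes I}. (i, j) \<in> prec I} \<noteq> {}"
    using assms(2) by blast
  then show "1 \<le> preds I j"
    by (simp add: preds_eq_card Suc_le_eq card_gt_0_iff)
  show "preds I j \<le> boxes I"
    unfolding preds_eq_card
    by (rule order.trans[OF card_mono[of "{1..boxes I}"]]) auto
qed

text \<open>Transitivity makes the predecessors of \<open>i\<close> predecessors of
  \<open>j\<close>; the inclusion is strict because \<open>j\<close> precedes itself but, by
  antisymmetry, not \<open>i\<close>.\<close>

lemma preds_strict_mono:
  assumes "I \<in> prec_game" "(i, j) \<in> prec I" "i \<noteq> j" "j \<in> {1..boxes I}"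
  shows "preds I i < preds I j"
  unfolding preds_eq_card
proof (rule psubset_card_mono)
  have po: "partial_order_on {1..boxes I} (prec I)"
    using assms by (simp add: prec_game_def)
  then have "(j, j) \<in> prec I" "(j, i) \<notin> prec I"
    using assms by (auto simp: partial_order_on_def preorder_on_def refl_on_def antisym_def)
  moreover have "(k, j) \<in> prec I" if "(k, i) \<in> prec I" for k
    using po that assms(2) by (auto simp: partial_order_on_def preorder_on_def dest: transD)
  ultimately show "{k \<in> {1..boxes I}. (k, i) \<in> prec I} \<subset> {k \<in> {1..boxes I}. (k, j) \<in> prec I}"
    using assms(4) by blast
qed simp

lemma pred_order_props:
  assumes "I \<in> prec_game"
  shows "set (pred_order I) = {1..boxes I}" "distinct (pred_order I)"
    "sorted (map (preds I) (pred_order I))" "length (pred_order I) = boxes I"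
proof -
  have *: "set (pred_order I) = {x \<in> set [1..<boxes I + 1]. 1 \<le> preds I x \<and> preds I x < boxes I + 1} \<and>
      distinct (pred_order I) \<and> sorted (map (preds I) (pred_order I))"
    unfolding pred_order_def by (rule bucket_sort_props) auto
  then show d: "distinct (pred_order I)" and "sorted (map (preds I) (pred_order I))"
    by simp_all
  have "{x \<in> set [1..<boxes I + 1]. 1 \<le> preds I x \<and> preds I x < boxes I + 1} = {1..boxes I}"
    using preds_range[OF assms] by (fastforce simp: less_Suc_eq_le)
  with * show s: "set (pred_order I) = {1..boxes I}" by simp
  show "length (pred_order I) = boxes I"
    using distinct_card[OF d] s by simp
qed

lemma map_pred_perm:
  assumes "I \<in> prec_game"
  shows "map (pred_perm I) [1..<boxes I + 1] = pred_order I"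
  by (rule nth_equalityI) (simp_all add: pred_order_props[OF assms] pred_perm_def del: upt_Suc)

lemma pred_perm_permutes:
  assumes "I \<in> prec_game"
  shows "pred_perm I permutes {1..boxes I}"
proof (rule bij_imp_permutes)
  have "pred_perm I ` {1..boxes I} = set (map (pred_perm I) [1..<boxes I + 1])"
    by (simp add: atLeastLessThanSuc_atLeastAtMost del: upt_Suc)
  then have "pred_perm I ` {1..boxes I} = {1..boxes I}"
    by (simp only: map_pred_perm[OF assms] pred_order_props(1)[OF assms])
  then show "bij_betw (pred_perm I) {1..boxes I} {1..boxes I}"
    by (simp add: bij_betw_def finite_surj_inj)
qed (auto simp: pred_perm_def)

lemma pred_perm_searcher_pure:
  assumes "I \<in> prec_game"
  shows "pred_perm I \<in> searcher_pure I"
proof -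
  note p = pred_perm_permutes[OF assms]
  have "inv (pred_perm I) i < inv (pred_perm I) j" if ij: "(i, j) \<in> prec I" "i \<noteq> j" for i j
  proof (rule ccontr)
    define u v where "u = inv (pred_perm I) i" and "v = inv (pred_perm I) j"
    assume "\<not> inv (pred_perm I) i < inv (pred_perm I) j"
    then have "v \<le> u" by (simp add: u_def v_def)
    have mem: "i \<in> {1..boxes I}" "j \<in> {1..boxes I}"
      using assms ij by (auto simp: prec_game_def partial_order_on_def preorder_on_def refl_on_def)
    then have "u \<in> {1..boxes I}" "v \<in> {1..boxes I}"
      by (simp_all only: u_def v_def permutes_in_image[OF permutes_inv[OF p]])
    moreover have "pred_perm I u = i" "pred_perm I v = j"
      by (simp_all add: u_def v_def permutes_inverses(1)[OF p])
    \<comment> \<open>The list is sorted by number of predecessors, so the box in the earlier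
      position \<open>v\<close> has no more of them than the one in position
      \<open>u\<close>.\<close>
    ultimately have "preds I j \<le> preds I i"
      using sorted_nth_mono[OF pred_order_props(3)[OF assms], of "v - 1" "u - 1"] \<open>v \<le> u\<close>
        pred_order_props(4)[OF assms] by (auto simp: pred_perm_def)
    then show False
      using preds_strict_mono[OF assms ij mem(2)] by simp
  qed
  then show ?thesis
    using p by (auto simp: searcher_pure_def)
qed

section \<open>Programs with time bounds\<close>

text \<open>The budget \<open>k\<close> counts instructions whose operands are all at most \<open>M\<close>.\<close>

definition runs :: "nat \<Rightarrow> com \<Rightarrow> state \<Rightarrow> nat \<Rightarrow> (state \<Rightarrow> bool) \<Rightarrow> bool" where
  "runs M P s k R \<longleftrightarrow> (\<exists>t s'. exec P s t s' \<and> t \<le> k * (1 + 2 * bits M) \<and> R s')"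

lemma bits_mono: "a \<le> b \<Longrightarrow> bits a \<le> bits b"
  unfolding bits_def by (rule floorlog_mono)

lemma bits_add_le: "a \<le> M \<Longrightarrow> b \<le> M \<Longrightarrow> bits a + bits b \<le> 2 * bits M"
  using bits_mono[of a M] bits_mono[of b M] by simp

lemma bits_le_double: "a \<le> M \<Longrightarrow> bits a \<le> 2 * bits M"
  using bits_mono[of a M] by simp

lemma runsI:
  "exec P s t s' \<Longrightarrow> t \<le> k * (1 + 2 * bits M) \<Longrightarrow> R s' \<Longrightarrow> runs M P s k R"
  unfolding runs_def by blast

text \<open>Each of these instructions is charged for at most two numbers, hence the unit
  \<open>1 + 2 * bits M\<close>. Results of arithmetic are not charged and need not be below
  \<open>M\<close>.\<close>

lemma runs_instr:
  "R s \<Longrightarrow> runs M Skip s 1 R"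
  "c \<le> M \<Longrightarrow> R (set_reg a c s) \<Longrightarrow> runs M (SetConst a c) s 1 R"
  "regs s b \<le> M \<Longrightarrow> regs s d \<le> M \<Longrightarrow> R (set_reg a (regs s b + regs s d) s) \<Longrightarrow>
    runs M (Add a b d) s 1 R"
  "regs s b \<le> M \<Longrightarrow> regs s d \<le> M \<Longrightarrow> R (set_reg a (regs s b - regs s d) s) \<Longrightarrow>
    runs M (Sub a b d) s 1 R"
  "regs s b \<le> M \<Longrightarrow> mem s (regs s b) \<le> M \<Longrightarrow> R (set_reg a (mem s (regs s b)) s) \<Longrightarrow>
    runs M (Load a b) s 1 R"
  "regs s a \<le> M \<Longrightarrow> R (s\<lparr>written := written s @ [regs s a]\<rparr>) \<Longrightarrow> runs M (Write a) s 1 R"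
  by (rule runsI[OF exec.Skip] runsI[OF exec.SetConst] runsI[OF exec.Add] runsI[OF exec.Sub]
      runsI[OF exec.Load] runsI[OF exec.Write],
      auto intro!: bits_le_double bits_add_le)+

lemma runs_weaken:
  assumes "runs M P s k R" "k \<le> k'" "\<And>s. R s \<Longrightarrow> R' s"
  shows "runs M P s k' R'"
proof -
  obtain t s' where "exec P s t s'" "t \<le> k * (1 + 2 * bits M)" "R s'"
    using assms(1) by (auto simp: runs_def)
  then show ?thesis
    using assms(2,3) by (blast intro: runsI order.trans[OF _ mult_le_mono1])
qed

lemma runs_Seq:
  assumes "runs M P s k R'" "\<And>s'. R' s' \<Longrightarrow> runs M Q s' l R"
  shows "runs M (Seq P Q) s (k + l) R"
proof -
  obtain t s' where 1: "exec P s t s'" "t \<le> k * (1 + 2 * bits M)" "R' s'"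
    using assms(1) by (auto simp: runs_def)
  obtain u s'' where 2: "exec Q s' u s''" "u \<le> l * (1 + 2 * bits M)" "R s''"
    using assms(2)[OF 1(3)] by (auto simp: runs_def)
  show ?thesis
    unfolding runs_def using exec.Seq[OF 1(1) 2(1)] 1(2) 2(2,3)
    by (metis add_mono add_mult_distrib)
qed

text \<open>Taking the run of the rest as the intermediate assertion lets \<open>intro\<close>
  execute straight-line code symbolically, without naming assertions.\<close>

lemma runs_Seq_instr:
  assumes "runs M P s 1 (\<lambda>s'. runs M Q s' l R)"
  shows "runs M (Seq P Q) s (Suc l) R"
  using runs_Seq[OF assms] by simp

lemma runs_IfNonzero:
  assumes "regs s a \<le> M"
    "regs s a \<noteq> 0 \<Longrightarrow> runs M P s k R" "regs s a = 0 \<Longrightarrow> runs M Q s k R"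
  shows "runs M (IfNonzero a P Q) s (Suc k) R"
proof (cases "regs s a = 0")
  case True
  then obtain t s' where 1: "exec Q s t s'" "t \<le> k * (1 + 2 * bits M)" "R s'"
    using assms(3) by (auto simp: runs_def)
  show ?thesis
    by (rule runsI[OF exec.IfFalse[OF True 1(1)]]) (use 1 bits_mono[OF assms(1)] in auto)
next
  case False
  then obtain t s' where 1: "exec P s t s'" "t \<le> k * (1 + 2 * bits M)" "R s'"
    using assms(2) by (auto simp: runs_def)
  show ?thesis
    by (rule runsI[OF exec.IfTrue[OF False 1(1)]]) (use 1 bits_mono[OF assms(1)] in auto)
qed

text \<open>The register tested holds the number of remaining iterations. Each iteration adds one
  test to the budget of the body, and one last test ends the loop.\<close>

lemma runs_WhileNonzero:
  assumes body: "\<And>i s. i < m \<Longrightarrow> Inv i s \<Longrightarrow> runs M P s k (Inv (Suc i))"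
    and counter: "\<And>i s. Inv i s \<Longrightarrow> regs s a = m - i"
    and "m \<le> M" "Inv 0 s"
  shows "runs M (WhileNonzero a P) s (m * Suc k + 1) (Inv m)"
proof -
  \<comment> \<open>Induction on the number \<open>r\<close> of iterations left, starting from an
    arbitrary intermediate state.\<close>
  have "runs M (WhileNonzero a P) s (r * Suc k + 1) (Inv m)" if "r \<le> m" "Inv (m - r) s" for r s
    using that
  proof (induction r arbitrary: s)
    case 0
    then have "regs s a = 0" "Inv m s" using counter by auto
    with exec.WhileFalse[of s a P] show ?case
      unfolding runs_def by (fastforce simp: bits_def floorlog_def)
  next
    case (Suc r)
    have a: "regs s a = Suc r" using counter[OF Suc.prems(2)] Suc.prems(1) by simp
    have "Suc (m - Suc r) = m - r" using Suc.prems(1) by simp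
    then have "runs M P s k (Inv (m - r))"
      using body[of "m - Suc r" s] Suc.prems by simp
    then obtain t s' where 1: "exec P s t s'" "t \<le> k * (1 + 2 * bits M)" "Inv (m - r) s'"
      by (auto simp: runs_def)
    obtain u s'' where 2: "exec (WhileNonzero a P) s' u s''"
      "u \<le> (r * Suc k + 1) * (1 + 2 * bits M)" "Inv m s''"
      using Suc.IH[OF _ 1(3)] Suc.prems(1) by (auto simp: runs_def)
    have "exec (WhileNonzero a P) s (1 + bits (regs s a) + t + u) s''"
      using a 1(1) 2(1) by (intro exec.WhileTrue) auto
    moreover have "bits (regs s a) \<le> bits M"
      using a Suc.prems(1) assms(3) by (intro bits_mono) simp
    then have "1 + bits (regs s a) + t + u \<le> (Suc r * Suc k + 1) * (1 + 2 * bits M)"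
      using 1(2) 2(2) by (simp add: algebra_simps)
    ultimately show ?case
      unfolding runs_def using 2(3) by blast
  qed
  from this[of m s] assms(4) show ?thesis by simp
qed

section \<open>The input encoding\<close>

lemma initial_simps:
  "regs (initial xs) r = (if r = 0 then length xs else 0)" "written (initial xs) = []"
  by (simp_all add: initial_def)

abbreviation input_mem :: "prec_instance \<Rightarrow> nat \<Rightarrow> nat" where
  "input_mem I \<equiv> mem (initial (encode_instance I))"

lemma nth_concat_equal_length:
  assumes "\<And>xs. xs \<in> set xss \<Longrightarrow> length xs = n" "i < length xss" "j < n"
  shows "concat xss ! (i * n + j) = xss ! i ! j"
  using assms
proof (induction xss arbitrary: i)
  case (Cons ys xss)
  then show ?case by (cases i) (auto simp: nth_append)
qed simp

lemma length_encode_instance: "length (encode_instance I) = 1 + boxes I + boxes I * boxes I"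
  by (simp add: encode_instance_def length_concat o_def sum_list_triv del: upt_Suc)

lemma input_mem_boxes: "input_mem I 0 = boxes I"
  by (simp add: initial_def encode_instance_def)

lemma input_mem_cost:
  assumes "j \<in> {1..boxes I}"
  shows "input_mem I j = cost I j"
  using assms by (simp add: initial_def length_encode_instance)
    (auto simp: encode_instance_def nth_append nth_Cons' simp del: upt_Suc)

text \<open>The matrix is stored row by row from cell \<open>boxes I + 1\<close> on; here rows are
  counted from 0 and columns from 1.\<close>

lemma input_mem_prec:
  assumes "i < boxes I" "j \<in> {1..boxes I}"
  shows "input_mem I (boxes I + i * boxes I + j) = of_bool ((Suc i, j) \<in> prec I)"
proof -
  let ?n = "boxes I" and ?row = "\<lambda>i. map (\<lambda>j. of_bool ((i, j) \<in> prec I)) [1..<boxes I + 1] :: nat list"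
  \<comment> \<open>This keeps the address within the input, away from the default value 0 of later
    cells.\<close>
  have "Suc i * ?n \<le> ?n * ?n"
    using assms(1) by (intro mult_le_mono1) simp
  then have "boxes I + i * boxes I + j < length (encode_instance I)"
    using assms(2) unfolding length_encode_instance by simp
  moreover obtain j' where "j = Suc j'"
    using assms(2) by (cases j) auto
  ultimately have "input_mem I (?n + i * ?n + j) =
      concat (map ?row [1..<?n + 1]) ! (i * ?n + (j - 1))"
    by (simp add: initial_def encode_instance_def nth_append del: upt_Suc)
  also have "\<dots> = map ?row [1..<?n + 1] ! i ! (j - 1)"
    by (rule nth_concat_equal_length) (use assms in auto)
  finally show ?thesis
    using assms \<open>j = Suc j'\<close> by (simp del: upt_Suc)
qed

section \<open>The Hider\<close>

text \<open>
  Register 1 holds 1 and register 3 holds 0; 2 and 4 count the remaining iterations of the two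
  loops, 5 is the current box, 6 its cost and 7 the sum of the costs.
\<close>

definition hider_program :: com where
  "hider_program =
    Seq (SetConst 1 1) (Seq (Load 2 3) (Seq (Add 4 2 3)
    (Seq (WhileNonzero 2
      (Seq (Add 5 5 1) (Seq (Load 6 5) (Seq (Add 7 7 6) (Sub 2 2 1)))))
    (Seq (SetConst 5 0)
    (WhileNonzero 4
      (Seq (Add 5 5 1) (Seq (Load 6 5) (Seq (Write 5) (Seq (Write 6) (Seq (Write 7)
        (Sub 4 4 1)))))))))))"

text \<open>The parameter \<open>i\<close> makes this the output after \<open>i\<close> iterations,
  as the loop invariant needs. The fractions stay unreduced over a common denominator.\<close>

definition hider_entries :: "prec_instance \<Rightarrow> nat \<Rightarrow> (nat \<times> nat \<times> nat) list" where
  "hider_entries I i = map (\<lambda>j. (j, cost I j, total_cost I)) [1..<i + 1]"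

lemma hider_program_runs:
  assumes "I \<in> prec_game"
  shows "runs (total_cost I) hider_program (initial (encode_instance I)) (20 * boxes I)
    (\<lambda>s. written s = encode_hider (hider_entries I (boxes I)))"
proof -
  let ?n = "boxes I" and ?S = "total_cost I" and ?m = "input_mem I"
  \<comment> \<open>The loop bodies have 4 and 6 instructions; the \<open>Suc\<close> form matches
    \<open>runs_Seq_instr\<close>.\<close>
  let ?b1 = "Suc (Suc (Suc 1))" and ?b2 = "Suc (Suc (Suc (Suc (Suc 1))))"
  have n: "1 \<le> ?n" "?n \<le> ?S"
    using assms boxes_le_total_cost by (auto simp: prec_game_def)
  have psum: "(\<Sum>j = 1..i. cost I j) \<le> ?S" if "i \<le> ?n" for i
    unfolding total_cost_def using that by (intro sum_mono2) auto
  have cost: "cost I j \<le> ?S" if "j \<in> {1..?n}" for j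
    unfolding total_cost_def using that by (intro member_le_sum) auto
  \<comment> \<open>Two passes occur because the common denominator is known only after the first.
    Register 4 keeps \<open>n\<close> for the second.\<close>
  define Inv1 where "Inv1 i s \<longleftrightarrow> regs s 1 = 1 \<and> regs s 2 = ?n - i \<and> regs s 4 = ?n \<and>
    regs s 5 = i \<and> regs s 7 = (\<Sum>j = 1..i. cost I j) \<and> mem s = ?m \<and> written s = []"
    for i and s :: state
  define Inv2 where "Inv2 i s \<longleftrightarrow> regs s 1 = 1 \<and> regs s 4 = ?n - i \<and>
    regs s 5 = i \<and> regs s 7 = ?S \<and> mem s = ?m \<and>
    written s = encode_hider (hider_entries I i)" for i and s :: state
  have body1: "runs ?S (Seq (Add 5 5 1) (Seq (Load 6 5) (Seq (Add 7 7 6) (Sub 2 2 1)))) s ?b1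
      (Inv1 (Suc i))" if "i < ?n" "Inv1 i s" for i s
    by (intro runs_Seq_instr runs_instr)
      (use that n psum[of i] cost[of "Suc i"] input_mem_cost[of "Suc i" I] in
        \<open>auto simp: Inv1_def set_reg_def\<close>)
  have body2: "runs ?S (Seq (Add 5 5 1) (Seq (Load 6 5) (Seq (Write 5) (Seq (Write 6)
      (Seq (Write 7) (Sub 4 4 1)))))) s ?b2 (Inv2 (Suc i))" if "i < ?n" "Inv2 i s" for i s
    by (intro runs_Seq_instr runs_instr)
      (use that n cost[of "Suc i"] input_mem_cost[of "Suc i" I] in
        \<open>auto simp: Inv2_def set_reg_def hider_entries_def encode_hider_def\<close>)
  have loop2: "runs ?S (WhileNonzero 4
      (Seq (Add 5 5 1) (Seq (Load 6 5) (Seq (Write 5) (Seq (Write 6) (Seq (Write 7)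
        (Sub 4 4 1))))))) s (?n * Suc ?b2 + 1) (Inv2 ?n)" if "Inv2 0 s" for s
    by (rule runs_WhileNonzero[where Inv = Inv2, OF body2 _ n(2) that]) (simp_all add: Inv2_def)
  have loop1: "runs ?S (WhileNonzero 2
      (Seq (Add 5 5 1) (Seq (Load 6 5) (Seq (Add 7 7 6) (Sub 2 2 1))))) s
      (?n * Suc ?b1 + 1) (Inv1 ?n)" if "Inv1 0 s" for s
    by (rule runs_WhileNonzero[where Inv = Inv1, OF body1 _ n(2) that]) (simp_all add: Inv1_def)
  have rest: "runs ?S (Seq (SetConst 5 0) (WhileNonzero 4
      (Seq (Add 5 5 1) (Seq (Load 6 5) (Seq (Write 5) (Seq (Write 6) (Seq (Write 7)
        (Sub 4 4 1)))))))) s (Suc (?n * Suc ?b2 + 1)) (Inv2 ?n)" if "Inv1 ?n s" for s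
    by (intro runs_Seq_instr runs_instr loop2)
      (use that in \<open>auto simp: Inv1_def Inv2_def set_reg_def total_cost_def hider_entries_def
        encode_hider_def\<close>)
  have "runs ?S hider_program (initial (encode_instance I))
      (Suc (Suc (Suc ((?n * Suc ?b1 + 1) + Suc (?n * Suc ?b2 + 1))))) (Inv2 ?n)"
    unfolding hider_program_def
    by (intro runs_Seq_instr runs_instr runs_Seq[OF loop1 rest])
      (use n in \<open>auto simp: Inv1_def set_reg_def input_mem_boxes initial_simps\<close>)
  \<comment> \<open>The exact budget is \<open>12 * n + 6\<close>, at most \<open>20 * n\<close> as
    \<open>n\<close> is at least 1.\<close>
  then show ?thesis
    by (rule runs_weaken) (use n(1) in \<open>auto simp: Inv2_def\<close>)
qed

lemma hider_entries_solution:
  assumes "I \<in> prec_game"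
  shows "hider_solution 2 I (encode_hider (hider_entries I (boxes I)))"
proof -
  have "sparse_form (proportional_hider I) (hider_entries I (boxes I))"
    using total_cost_pos[OF assms]
    by (auto simp: sparse_form_def hider_entries_def set_proportional_hider[OF assms] o_def
        pmf_proportional_hider[OF assms] image_image simp del: upt_Suc)
  then show ?thesis
    \<comment> \<open>\<open>pred_perm I\<close> serves to show that the Searcher has a pure
      strategy, as the bounds on the value require.\<close>
    unfolding hider_solution_def
    using proportional_hider_optimal[OF assms pred_perm_searcher_pure[OF assms]] by blast
qed

section \<open>The Searcher\<close>

text \<open>
  Registers 1, 2 and 3 hold 1, \<open>n\<close> and 0; 4, 6 and 8 count the remaining iterations of the three
  nested loops. Register 5 is the number \<open>k\<close> of predecessors wanted, 7 is the current box \<open>j\<close>, and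
  10 becomes the number of its predecessors. The matrix entry for \<open>(i, j)\<close> is in cell
  \<open>n + (i - 1) * n + j\<close>, so the address in register 9 grows by \<open>n\<close> from row to row.
\<close>

definition count_preds :: com where
  "count_preds = WhileNonzero 8
    (Seq (Load 11 9) (Seq (Add 10 10 11) (Seq (Add 9 9 2) (Sub 8 8 1))))"

definition write_bucket :: com where
  "write_bucket = WhileNonzero 6
    (Seq (Add 7 7 1) (Seq (Add 8 2 3) (Seq (Add 9 2 7) (Seq (SetConst 10 0) (Seq count_preds
    (Seq (Sub 11 10 5) (Seq (Sub 12 5 10) (Seq (Add 11 11 12)
    (Seq (IfNonzero 11 Skip (Write 7)) (Sub 6 6 1))))))))))"

definition searcher_program :: com where
  "searcher_program =
    Seq (SetConst 1 1) (Seq (Load 2 3) (Seq (Add 4 2 3)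
    (Seq (WhileNonzero 4
      (Seq (Add 5 5 1) (Seq (Add 6 2 3) (Seq (SetConst 7 0) (Seq write_bucket (Sub 4 4 1))))))
    (Seq (Write 1) (Write 1)))))"

context
  fixes I :: prec_instance and n M :: nat
  assumes I: "I \<in> prec_game"
  defines "n \<equiv> boxes I" and "M \<equiv> boxes I + boxes I * boxes I"
begin

text \<open>\<open>M\<close> is the address of the last input cell. It bounds all operands without
  reference to the costs, which the Searcher program never reads.\<close>

lemma n_bounds: "1 \<le> n" "n \<le> M" "1 \<le> M" "i < n \<Longrightarrow> j \<le> n \<Longrightarrow> n + i * n + j \<le> M"
proof -
  show "1 \<le> n" "n \<le> M" "1 \<le> M"
    using I by (auto simp: n_def M_def prec_game_def)
  assume "i < n" "j \<le> n"
  then have "Suc i * n \<le> n * n" by (intro mult_le_mono1) simp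
  with \<open>j \<le> n\<close> show "n + i * n + j \<le> M" by (simp add: n_def M_def)
qed

text \<open>The part of the state that the two inner loops leave unchanged.\<close>

definition searcher_env :: "nat \<Rightarrow> nat \<Rightarrow> state \<Rightarrow> bool" where
  "searcher_env c k s \<longleftrightarrow> regs s 1 = 1 \<and> regs s 2 = n \<and> regs s 3 = 0 \<and> regs s 4 = c \<and>
     regs s 5 = k \<and> mem s = input_mem I"

lemma count_preds_runs:
  assumes "searcher_env c k s" "regs s 6 = d" "regs s 7 = j" "regs s 8 = n" "regs s 9 = n + j"
    "regs s 10 = 0" "written s = W" "j \<in> {1..n}"
  shows "runs M count_preds s (n * 5 + 1) (\<lambda>s. searcher_env c k s \<and> regs s 6 = d \<and>
    regs s 7 = j \<and> regs s 10 = preds I j \<and> written s = W)"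
proof -
  \<comment> \<open>After the last row the address in register 9 exceeds \<open>M\<close>, but it is
    reset before it is an operand again.\<close>
  define Inv where "Inv i s \<longleftrightarrow> searcher_env c k s \<and> regs s 6 = d \<and> regs s 7 = j \<and>
    regs s 8 = n - i \<and> regs s 9 = n + i * n + j \<and>
    regs s 10 = (\<Sum>l = 1..i. of_bool ((l, j) \<in> prec I)) \<and> written s = W" for i and s :: state
  let ?b = "Suc (Suc (Suc 1))"
  have psum: "(\<Sum>l = 1..i. of_bool ((l, j) \<in> prec I)) \<le> i" for i :: nat
    by (induction i) auto
  have body: "runs M (Seq (Load 11 9) (Seq (Add 10 10 11) (Seq (Add 9 9 2) (Sub 8 8 1)))) s ?b
      (Inv (Suc i))" if "i < n" "Inv i s" for i s
    by (intro runs_Seq_instr runs_instr)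
      (use that n_bounds(1-3) n_bounds(4)[of i j] psum[of i] assms(8)
          input_mem_prec[of i I j, folded n_def] in
        \<open>auto simp: Inv_def searcher_env_def set_reg_def\<close>)
  have "runs M count_preds s (n * Suc ?b + 1) (Inv n)"
    unfolding count_preds_def
    by (rule runs_WhileNonzero[where Inv = Inv, OF body _ n_bounds(2)])
      (use assms in \<open>auto simp: Inv_def\<close>)
  moreover have "preds I j = (\<Sum>l = 1..n. of_bool ((l, j) \<in> prec I))"
    by (simp add: preds_def n_def)
  ultimately show ?thesis
    by - (rule runs_weaken[where R = "Inv n"], auto simp: Inv_def)
qed

lemma write_bucket_runs:
  assumes "searcher_env c k s" "regs s 6 = n" "regs s 7 = 0" "written s = W" "k \<le> n"
  shows "runs M write_bucket s (n * (5 * n + 13) + 1) (\<lambda>s. searcher_env c k s \<and>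
    written s = W @ filter (\<lambda>j. preds I j = k) [1..<n + 1])"
proof -
  define Inv where "Inv i s \<longleftrightarrow> searcher_env c k s \<and> regs s 6 = n - i \<and> regs s 7 = i \<and>
    written s = W @ filter (\<lambda>j. preds I j = k) [1..<i + 1]" for i and s :: state
  let ?b = "Suc (Suc (Suc (Suc ((n * 5 + 1) + Suc (Suc (Suc (Suc 1 + 1)))))))"
  have body: "runs M (Seq (Add 7 7 1) (Seq (Add 8 2 3) (Seq (Add 9 2 7) (Seq (SetConst 10 0)
      (Seq count_preds (Seq (Sub 11 10 5) (Seq (Sub 12 5 10) (Seq (Add 11 11 12)
      (Seq (IfNonzero 11 Skip (Write 7)) (Sub 6 6 1)))))))))) s ?b (Inv (Suc i))"
    if i: "i < n" "Inv i s" for i and s :: state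
  proof -
    define D where "D s \<longleftrightarrow> searcher_env c k s \<and> regs s 6 = n - i \<and> regs s 7 = Suc i \<and>
      regs s 10 = preds I (Suc i) \<and>
      written s = W @ filter (\<lambda>j. preds I j = k) [1..<i + 1]" for s :: state
    have pn: "preds I (Suc i) \<le> n"
      using i preds_range(2)[OF I, of "Suc i"] by (simp add: n_def)
    \<comment> \<open>Equality test by truncated subtraction: the sum is 0 exactly when the count
      equals \<open>k\<close>.\<close>
    define E where "E s \<longleftrightarrow> D s \<and> regs s 11 = (preds I (Suc i) - k) + (k - preds I (Suc i))"
      for s :: state
    have tail: "runs M (Seq (IfNonzero 11 Skip (Write 7)) (Sub 6 6 1)) s (Suc 1 + 1) (Inv (Suc i))"
      if "E s" for s
    proof (rule runs_Seq)
      show "runs M (IfNonzero 11 Skip (Write 7)) s (Suc 1)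
          (\<lambda>s. searcher_env c k s \<and> regs s 6 = n - i \<and> regs s 7 = Suc i \<and>
            written s = W @ filter (\<lambda>j. preds I j = k) [1..<Suc i + 1])"
        by (intro runs_IfNonzero runs_instr)
          (use that pn i assms(5) n_bounds(2) in
            \<open>auto simp: E_def D_def searcher_env_def set_reg_def\<close>)
    qed (intro runs_instr, use n_bounds(2,3) i in
      \<open>auto simp: searcher_env_def Inv_def set_reg_def\<close>)
    have rest: "runs M (Seq (Sub 11 10 5) (Seq (Sub 12 5 10) (Seq (Add 11 11 12)
        (Seq (IfNonzero 11 Skip (Write 7)) (Sub 6 6 1))))) s
        (Suc (Suc (Suc (Suc 1 + 1)))) (Inv (Suc i))" if "D s" for s
      by (intro runs_Seq_instr runs_instr tail)
        (use that pn i assms(5) n_bounds(2) in \<open>auto simp: E_def D_def searcher_env_def set_reg_def\<close>)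
    show "runs M (Seq (Add 7 7 1) (Seq (Add 8 2 3) (Seq (Add 9 2 7) (Seq (SetConst 10 0)
        (Seq count_preds (Seq (Sub 11 10 5) (Seq (Sub 12 5 10) (Seq (Add 11 11 12)
        (Seq (IfNonzero 11 Skip (Write 7)) (Sub 6 6 1)))))))))) s
        ?b (Inv (Suc i))"
      by (intro runs_Seq_instr runs_instr
          runs_Seq[OF count_preds_runs[of c k _ "n - i" "Suc i"] rest])
        (use i n_bounds(2,3) in \<open>auto simp: Inv_def D_def searcher_env_def set_reg_def\<close>)
  qed
  have "runs M write_bucket s (n * Suc ?b + 1) (Inv n)"
    unfolding write_bucket_def
    by (rule runs_WhileNonzero[where Inv = Inv, OF body _ n_bounds(2)])
      (use assms in \<open>auto simp: Inv_def\<close>)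
  then show ?thesis
    by - (rule runs_weaken[where R = "Inv n"], auto simp: Inv_def algebra_simps)
qed

lemma searcher_program_runs:
  "runs M searcher_program (initial (encode_instance I)) (40 * n ^ 3)
    (\<lambda>s. written s = pred_order I @ [1, 1])"
proof -
  define Inv where "Inv i s \<longleftrightarrow> searcher_env (n - i) i s \<and>
    written s = concat (map (\<lambda>k. filter (\<lambda>j. preds I j = k) [1..<n + 1]) [1..<i + 1])" for i and s :: state
  let ?b = "Suc (Suc (Suc ((n * (5 * n + 13) + 1) + 1)))"
  have body: "runs M (Seq (Add 5 5 1) (Seq (Add 6 2 3) (Seq (SetConst 7 0)
      (Seq write_bucket (Sub 4 4 1))))) s ?b (Inv (Suc i))" if i: "i < n" "Inv i s" for i and s :: state
    by (intro runs_Seq_instr runs_instr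
        runs_Seq[OF write_bucket_runs[where c = "n - i" and k = "Suc i"]])
      (use i n_bounds(2,3) in \<open>auto simp: Inv_def searcher_env_def set_reg_def simp del: upt_Suc\<close>,
        auto)
  have loop: "runs M (WhileNonzero 4 (Seq (Add 5 5 1) (Seq (Add 6 2 3) (Seq (SetConst 7 0)
      (Seq write_bucket (Sub 4 4 1)))))) s (n * Suc ?b + 1) (Inv n)" if "Inv 0 s" for s
    by (rule runs_WhileNonzero[where Inv = Inv, OF body _ n_bounds(2) that])
      (auto simp: Inv_def searcher_env_def)
  \<comment> \<open>The two ones are numerator and denominator of the probability of the only
    order.\<close>
  have final: "runs M (Seq (Write 1) (Write 1)) s (Suc 1) (\<lambda>s. written s = pred_order I @ [1, 1])"
    if "Inv n s" for s
    by (intro runs_Seq_instr runs_instr)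
      (use that n_bounds(3) in \<open>auto simp: Inv_def searcher_env_def pred_order_def n_def
        simp del: upt_Suc\<close>)
  have "runs M searcher_program (initial (encode_instance I))
      (Suc (Suc (Suc ((n * Suc ?b + 1) + Suc 1)))) (\<lambda>s. written s = pred_order I @ [1, 1])"
    unfolding searcher_program_def
    by (intro runs_Seq_instr runs_instr runs_Seq[OF loop final])
      (use n_bounds(2,3) in \<open>auto simp: Inv_def searcher_env_def set_reg_def input_mem_boxes initial_simps n_def\<close>)
  then show ?thesis
  proof (rule runs_weaken)
    \<comment> \<open>Every power is replaced by the cube; the coefficients of the exact budget add
      up to 30.\<close>
    have "1 \<le> n ^ 3" "n \<le> n ^ 3" "n ^ 2 \<le> n ^ 3"
      using n_bounds(1) by (simp_all add: self_le_power power_increasing)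
    moreover have "Suc (Suc (Suc ((n * Suc ?b + 1) + Suc 1))) = 6 + 6 * n + 13 * n ^ 2 + 5 * n ^ 3"
      by (simp add: algebra_simps power2_eq_square power3_eq_cube)
    ultimately show "Suc (Suc (Suc ((n * Suc ?b + 1) + Suc 1))) \<le> 40 * n ^ 3"
      by linarith
  qed
qed

end

lemma pred_order_solution:
  assumes "I \<in> prec_game"
  shows "searcher_solution 2 I (pred_order I @ [1, 1])"
proof -
  have "sparse_form (return_pmf (pred_perm I)) [(pred_perm I, 1, 1)]"
    by (simp add: sparse_form_def)
  moreover have "encode_searcher (boxes I) [(pred_perm I, 1, 1)] = pred_order I @ [1, 1]"
    using map_pred_perm[OF assms] by (simp add: encode_searcher_def)
  ultimately show ?thesis
    unfolding searcher_solution_def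
    using pure_searcher_optimal[OF assms pred_perm_searcher_pure[OF assms]] by metis
qed

section \<open>Running times\<close>

lemma bits_le: "bits k \<le> k"
  unfolding bits_def by (simp add: floorlog_le_iff)

text \<open>The total cost may be exponential in the size measure, so the Hider needs this bound;
  for the Searcher, whose \<open>M\<close> is polynomial in the number of boxes,
  \<open>bits_le\<close> suffices.\<close>

lemma bits_le_log:
  assumes "0 < k"
  shows "bits k \<le> log 2 k + 1"
  using assms by (simp add: bits_def floorlog_def)

theorem theorem3:
  "(\<exists>P. poly_time_solves P prec_game encode_instance instance_size (hider_solution 2)) \<and>
   (\<exists>Q. poly_time_solves Q prec_game encode_instance instance_size (searcher_solution 2))"
proof (intro conjI exI)
  show "poly_time_solves hider_program prec_game encode_instance instance_size (hider_solution 2)"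
    unfolding poly_time_solves_def
  proof (rule exI, rule ballI)
    fix I assume I: "I \<in> prec_game"
    let ?z = "instance_size I"
    obtain t s where ts: "exec hider_program (initial (encode_instance I)) t s"
      "t \<le> 20 * boxes I * (1 + 2 * bits (total_cost I))"
      "written s = encode_hider (hider_entries I (boxes I))"
      using hider_program_runs[OF I] by (auto simp: runs_def)
    have le: "total_cost I \<le> largest_payoff I"
      by (rule total_cost_le_largest_payoff[OF I pred_perm_searcher_pure[OF I]])
    have n: "1 \<le> boxes I" using I by (simp add: prec_game_def)
    have log: "bits (total_cost I) \<le> log 2 (largest_payoff I) + 1"
      using bits_le_log[OF total_cost_pos[OF I]] le total_cost_pos[OF I]
      by (smt (verit) log_mono of_nat_0_less_iff of_nat_mono)
    have log0: "0 \<le> log 2 (largest_payoff I)"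
      using le total_cost_pos[OF I] by simp
    have "real t \<le> real (20 * boxes I * (1 + 2 * bits (total_cost I)))"
      using ts(2) by (rule of_nat_mono)
    also have "\<dots> = 20 * real (boxes I) * (1 + 2 * bits (total_cost I))"
      by (simp add: algebra_simps)
    \<comment> \<open>The last factor is at most \<open>3 + 2 * log 2 (largest_payoff I)\<close>,
      and 3 is at most \<open>3 * boxes I\<close>.\<close>
    also have "\<dots> \<le> 20 * ?z * (3 * ?z)"
      using log log0 n by (intro mult_mono) (auto simp: instance_size_def)
    finally have "real t \<le> poly (monom 60 2) ?z"
      by (simp add: poly_monom power2_eq_square)
    then show "\<exists>t s. exec hider_program (initial (encode_instance I)) t s \<and>
        real t \<le> poly (monom 60 2) ?z \<and> hider_solution 2 I (written s)"
      using ts(1,3) hider_entries_solution[OF I] by metis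
  qed
next
  show "poly_time_solves searcher_program prec_game encode_instance instance_size
      (searcher_solution 2)"
    unfolding poly_time_solves_def
  proof (rule exI, rule ballI)
    fix I assume I: "I \<in> prec_game"
    let ?n = "boxes I" and ?z = "instance_size I"
    obtain t s where ts: "exec searcher_program (initial (encode_instance I)) t s"
      "t \<le> 40 * ?n ^ 3 * (1 + 2 * bits (?n + ?n * ?n))" "written s = pred_order I @ [1, 1]"
      using searcher_program_runs[OF I] by (auto simp: runs_def)
    have n: "1 \<le> ?n" using I by (simp add: prec_game_def)
    have "1 + 2 * bits (?n + ?n * ?n) \<le> 1 + 2 * (?n + ?n * ?n)"
      using bits_le[of "?n + ?n * ?n"] by simp
    also have "\<dots> \<le> 5 * ?n ^ 2"
    proof -
      \<comment> \<open>Abstracting the square to \<open>q\<close> makes the inequality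
        linear.\<close>
      have "1 + 2 * (?n + q) \<le> 5 * q" if "?n \<le> q" for q
        using n that by simp
      then show ?thesis by (simp add: power2_eq_square)
    qed
    finally have "t \<le> 40 * ?n ^ 3 * (5 * ?n ^ 2)"
      using ts(2) by (meson le_trans mult_le_mono2)
    also have "\<dots> = 200 * ?n ^ 5"
      by (simp flip: power_add)
    finally have "real t \<le> 200 * real ?n ^ 5"
      by (metis of_nat_le_iff of_nat_mult of_nat_numeral of_nat_power)
    \<comment> \<open>The largest payoff is at least 1, so its logarithm is nonnegative.\<close>
    moreover have "real ?n \<le> ?z"
      using total_cost_le_largest_payoff[OF I pred_perm_searcher_pure[OF I]] total_cost_pos[OF I]
      by (simp add: instance_size_def)
    then have "real ?n ^ 5 \<le> ?z ^ 5"
      by (rule power_mono) simp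
    ultimately have "real t \<le> poly (monom 200 5) ?z"
      by (simp add: poly_monom)
    then show "\<exists>t s. exec searcher_program (initial (encode_instance I)) t s \<and>
        real t \<le> poly (monom 200 5) ?z \<and> searcher_solution 2 I (written s)"
      using ts(1,3) pred_order_solution[OF I] by metis
  qed
qed

end
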